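(* Let $d\ge 1$, $\varepsilon>0$, $\Omega=[-1,1]^d$. The convex splitting of the modified Crank-Nicolson scheme for the Allen-Cahn equation is unconditionally stable: for every $\Delta t>0$ and every given smooth $\phi^n:\Omega\to\mathbb{R}$ with $\frac{\partial \phi^n}{\partial \mathbf{n}}=0$ on $\partial\Omega$, there is at most one smooth function $\phi^{n+1}:\Omega\to\mathbb{R}$ satisfying $$\frac{\phi^{n+1}-\phi^n}{\Delta t}-\frac12\big(\Delta\phi^{n+1}+\Delta\phi^n\big)+\frac{1}{4\varepsilon^2}\big(\phi^{n+1}+\phi^n\big)\big((\phi^{n+1})^2+(\phi^n)^2\big)-\frac{1}{\varepsilon^2}\phi^n=0\ \text{ in }\Omega,\qquad \frac{\partial \phi^{n+1}}{\partial \mathbf{n}}=0\ \text{ on }\partial\Omega .$$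
   Context: The Allen-Cahn equation is $\phi_t-\Delta\phi+\frac{1}{\varepsilon^2}(\phi^3-\phi)=0$ on $\Omega=[-1,1]^d$ with homogeneous Neumann boundary conditions. $\Delta$ applied to a function is the Laplacian in $x=(x_1,\dots,x_d)$; $\Delta t$ is a single symbol, the time step size. $\mathbf{n}$ is the unit outward normal; on the cube the condition $\frac{\partial\phi}{\partial\mathbf{n}}=0$ means $\partial_{x_i}\phi=0$ on each face $x_i=\pm1$. "Smooth" means $C^\infty$ up to the boundary. A scheme relating $\phi^n$ and $\phi^{n+1}$ is called stable if $\phi^{n+1}$ is unique given $\phi^n$; unconditionally stable means this holds for every time step size. *)

theory Defs
  imports "HOL-Analysis.Analysis"
begin

definition Omega :: "(real ^ 'd) set" where
  "Omega = cbox (vec (-1)) (vec 1)"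

text \<open>On the faces this is the one-sided derivative. Since \<^const>\<open>Omega\<close> is a box with nonempty
  interior, the derivative within it is unique at each of its points, boundary included, and depends
  only on the values of \<open>f\<close> on \<^const>\<open>Omega\<close>.\<close>

definition pderiv_Omega :: "'d \<Rightarrow> (real ^ 'd \<Rightarrow> real) \<Rightarrow> real ^ 'd \<Rightarrow> real" where
  "pderiv_Omega i f x = frechet_derivative f (at x within Omega) (axis i 1)"

definition laplacian :: "(real ^ 'd \<Rightarrow> real) \<Rightarrow> real ^ 'd \<Rightarrow> real" where
  "laplacian f x = (\<Sum>i\<in>UNIV. pderiv_Omega i (pderiv_Omega i f) x)"

primrec Ck_Omega :: "nat \<Rightarrow> (real ^ 'd \<Rightarrow> real) \<Rightarrow> bool" where
  "Ck_Omega 0 f \<longleftrightarrow> continuous_on Omega f"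
| "Ck_Omega (Suc k) f \<longleftrightarrow>
     f differentiable_on Omega \<and> (\<forall>i. Ck_Omega k (pderiv_Omega i f))"

text \<open>\<open>C\<^sup>\<infinity>\<close> up to the boundary: by the mean value theorem this is the same as all partial derivatives
  in the open cube existing and extending continuously to the closed cube.\<close>

definition smooth_Omega :: "(real ^ 'd \<Rightarrow> real) \<Rightarrow> bool" where
  "smooth_Omega f \<longleftrightarrow> (\<forall>k. Ck_Omega k f)"

definition neumann :: "(real ^ 'd \<Rightarrow> real) \<Rightarrow> bool" where
  "neumann f \<longleftrightarrow> (\<forall>x\<in>Omega. \<forall>i. x $ i = -1 \<or> x $ i = 1 \<longrightarrow> pderiv_Omega i f x = 0)"

text \<open>A one-step scheme is given by its equation, as a relation between the time step size, the
  current and the next time level. Functions are total in HOL, so two time levels are identified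
  if they agree on \<^const>\<open>Omega\<close>; uniqueness means at most one, and does not include existence.\<close>

type_synonym 'd scheme = "real \<Rightarrow> (real ^ 'd \<Rightarrow> real) \<Rightarrow> (real ^ 'd \<Rightarrow> real) \<Rightarrow> bool"

definition stable :: "'d::finite scheme \<Rightarrow> real \<Rightarrow> bool" where
  "stable S dt \<longleftrightarrow>
     (\<forall>\<phi> \<psi>\<^sub>1 \<psi>\<^sub>2. smooth_Omega \<phi> \<and> neumann \<phi> \<and>
        smooth_Omega \<psi>\<^sub>1 \<and> neumann \<psi>\<^sub>1 \<and> S dt \<phi> \<psi>\<^sub>1 \<and>
        smooth_Omega \<psi>\<^sub>2 \<and> neumann \<psi>\<^sub>2 \<and> S dt \<phi> \<psi>\<^sub>2 \<longrightarrow>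
        (\<forall>x\<in>Omega. \<psi>\<^sub>1 x = \<psi>\<^sub>2 x))"

definition unconditionally_stable :: "'d::finite scheme \<Rightarrow> bool" where
  "unconditionally_stable S \<longleftrightarrow> (\<forall>dt>0. stable S dt)"

text \<open>Convex splitting of the modified Crank-Nicolson scheme for the Allen-Cahn equation;
  \<open>\<phi>\<close> is the current and \<open>\<psi>\<close> the next time level.\<close>

definition convex_splitting_mCN :: "real \<Rightarrow> 'd::finite scheme" where
  "convex_splitting_mCN \<epsilon> dt \<phi> \<psi> \<longleftrightarrow>
     (\<forall>x\<in>Omega.
        (\<psi> x - \<phi> x) / dt - 1 / 2 * (laplacian \<psi> x + laplacian \<phi> x)
        + 1 / (4 * \<epsilon>\<^sup>2) * (\<psi> x + \<phi> x) * ((\<psi> x)\<^sup>2 + (\<phi> x)\<^sup>2) - 1 / \<epsilon>\<^sup>2 * \<phi> x = 0)"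

end

theory Submission
  imports Defs
begin

text \<open>The proof is by the maximum principle, so no integration by parts is needed. Let \<open>w\<close> be the
  difference \<open>\<psi>\<^sub>1 - \<psi>\<^sub>2\<close> of two solutions, and let \<open>x\<close> be a point of the closed cube at which \<open>w\<close>
  is maximal. At \<open>x\<close> each partial derivative of \<open>w\<close> vanishes: by the Neumann condition if \<open>x\<close> lies
  on a face normal to the direction, and as at any interior extremum otherwise. A one-sided second
  derivative test along a coordinate segment inside the cube then gives \<open>\<Delta>w(x) \<le> 0\<close>, also on
  faces, edges and corners (\<open>laplacian_le_at_max\<close>). Subtracting the two equations at \<open>x\<close> gives
  \<open>w(x) / dt + (g(\<psi>\<^sub>1(x)) - g(\<psi>\<^sub>2(x))) / (4 \<epsilon>\<^sup>2) = \<Delta>w(x) / 2 \<le> 0\<close>, where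
  \<open>g(y) = (y + \<phi>(x)) (y\<^sup>2 + \<phi>(x)\<^sup>2)\<close> is nondecreasing in \<open>y\<close>, so \<open>w(x) > 0\<close> is impossible for any
  \<open>dt > 0\<close>. Hence \<open>\<psi>\<^sub>1 \<le> \<psi>\<^sub>2\<close>, and equality follows by symmetry.\<close>

lemma deriv_le_0_at_left_max:
  fixes h :: "real \<Rightarrow> real"
  assumes "d > 0" and max: "\<And>t. t \<in> {0..d} \<Longrightarrow> h t \<le> h 0"
    and der: "(h has_real_derivative k) (at 0 within {0..d})"
  shows "k \<le> 0"
proof (rule ccontr)
  assume "\<not> k \<le> 0"
  then obtain e where "e > 0"
    and e: "\<And>t. \<lbrakk>t > 0; 0 + t \<in> {0..d}; t < e\<rbrakk> \<Longrightarrow> h 0 < h (0 + t)"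
    using has_real_derivative_pos_inc_right[OF der] by auto
  define t where "t = min d (e / 2)"
  have "t > 0" "t \<in> {0..d}" "t < e"
    using \<open>d > 0\<close> \<open>e > 0\<close> by (auto simp: t_def)
  then show False
    using e[of t] max[of t] by simp
qed

lemma second_deriv_le_0_at_left_max:
  fixes h h' :: "real \<Rightarrow> real"
  assumes "d > 0" and max: "\<And>t. t \<in> {0..d} \<Longrightarrow> h t \<le> h 0"
    and der: "\<And>t. t \<in> {0..d} \<Longrightarrow> (h has_real_derivative h' t) (at t within {0..d})"
    and "h' 0 = 0"
    and der2: "(h' has_real_derivative k) (at 0 within {0..d})"
  shows "k \<le> 0"
proof (rule ccontr)
  assume "\<not> k \<le> 0"
  then obtain e where "e > 0"
    and e: "\<And>t. \<lbrakk>t > 0; 0 + t \<in> {0..d}; t < e\<rbrakk> \<Longrightarrow> h' 0 < h' (0 + t)"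
    using has_real_derivative_pos_inc_right[OF der2] by auto
  define t where "t = min d (e / 2)"
  have t: "t > 0" "t \<le> d" "t < e"
    using \<open>d > 0\<close> \<open>e > 0\<close> by (auto simp: t_def)
  have "\<exists>z\<in>{0<..<t}. h t - h 0 = h' z * (t - 0)"
  proof (rule mvt_simple[OF \<open>t > 0\<close>, of h "\<lambda>z. (*) (h' z)"])
    fix s assume "0 \<le> s" "s \<le> t"
    then have "(h has_real_derivative h' s) (at s within {0..t})"
      using t by (intro DERIV_subset[OF der]) auto
    then show "(h has_derivative (*) (h' s)) (at s within {0..t})"
      by (simp add: has_field_derivative_def)
  qed
  then obtain z where z: "0 < z" "z < t" "h t - h 0 = h' z * t" by auto
  have "h' z > 0" using e[of z] z t \<open>h' 0 = 0\<close> by simp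
  then have "h t > h 0" using z t by (metis diff_gt_0_iff_gt mult_pos_pos)
  then show False using max[of t] t by simp
qed

text \<open>Directional derivatives along a segment in the cube issuing from \<open>x\<close>; no openness of the
  segment or of the cube is required, since all derivatives are taken within the respective set.\<close>

lemma pderiv_Omega_along_segment:
  fixes f :: "real ^ 'd \<Rightarrow> real"
  assumes diff: "f differentiable_on Omega"
    and seg: "\<And>t. t \<in> {0..d} \<Longrightarrow> x + (t * s) *\<^sub>R axis i 1 \<in> Omega"
    and t: "t \<in> {0..d}"
  shows "((\<lambda>t. f (x + (t * s) *\<^sub>R axis i 1)) has_real_derivative
           s * pderiv_Omega i f (x + (t * s) *\<^sub>R axis i 1)) (at t within {0..d})"
proof -
  define \<gamma> where "\<gamma> = (\<lambda>t. x + (t * s) *\<^sub>R (axis i 1 :: real ^ 'd))"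
  define D where "D = frechet_derivative f (at (\<gamma> t) within Omega)"
  have D: "(f has_derivative D) (at (\<gamma> t) within Omega)"
    using diff seg[OF t] by (simp add: D_def \<gamma>_def differentiable_on_def frechet_derivative_works)
  have \<gamma>: "(\<gamma> has_derivative (\<lambda>u. (u * s) *\<^sub>R axis i 1)) (at t within {0..d})"
    unfolding \<gamma>_def by (auto intro!: derivative_eq_intros)
  have "\<gamma> ` {0..d} \<subseteq> Omega" using seg by (auto simp: \<gamma>_def)
  note has_derivative_in_compose[of \<gamma> _ t "{0..d}" f D, OF \<gamma> has_derivative_subset[OF D this]]
  moreover have "D ((u * s) *\<^sub>R axis i 1) = s * pderiv_Omega i f (\<gamma> t) * u" for u
    using linear_scale[OF has_derivative_linear[OF D], of "u * s" "axis i 1"]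
    by (simp only: pderiv_Omega_def flip: D_def) simp
  ultimately show ?thesis
    by (simp add: has_field_derivative_def \<gamma>_def)
qed

lemma mem_Omega_iff: "x \<in> Omega \<longleftrightarrow> (\<forall>i. -1 \<le> x $ i \<and> x $ i \<le> 1)"
  by (simp add: Omega_def mem_box_cart)

lemma second_pderiv_le_at_max:
  fixes f g :: "real ^ 'd::finite \<Rightarrow> real"
  assumes f: "smooth_Omega f" "neumann f" and g: "smooth_Omega g" "neumann g"
    and x: "x \<in> Omega" and max: "\<And>y. y \<in> Omega \<Longrightarrow> f y - g y \<le> f x - g x"
  shows "pderiv_Omega i (pderiv_Omega i f) x \<le> pderiv_Omega i (pderiv_Omega i g) x"
proof -
  have diff: "f differentiable_on Omega" "pderiv_Omega i f differentiable_on Omega"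
    "g differentiable_on Omega" "pderiv_Omega i g differentiable_on Omega"
    using f(1)[unfolded smooth_Omega_def, rule_format, of "Suc (Suc 0)"]
      g(1)[unfolded smooth_Omega_def, rule_format, of "Suc (Suc 0)"] by simp_all
  define p where "p = (\<lambda>y. pderiv_Omega i f y - pderiv_Omega i g y)"
  define k where "k = pderiv_Omega i (pderiv_Omega i f) x - pderiv_Omega i (pderiv_Omega i g) x"
  define \<gamma> where "\<gamma> = (\<lambda>s t. x + (t * s) *\<^sub>R (axis i 1 :: real ^ 'd))"
  \<comment> \<open>The segment of length \<open>d\<close> from \<open>x\<close> in direction \<open>s\<close> times the \<open>i\<close>-th unit vector stays in the
    cube. Only \<open>s = 1\<close> and \<open>s = -1\<close> are used; for \<open>x $ i = 1\<close> or \<open>x $ i = -1\<close> just one of them is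
    possible, and it suffices since the second derivative does not depend on the sign of \<open>s\<close>.\<close>
  define feasible where "feasible = (\<lambda>s d. d > 0 \<and> (\<forall>t\<in>{0..d}. \<gamma> s t \<in> Omega))"
  have \<gamma>0: "\<gamma> s 0 = x" for s by (simp add: \<gamma>_def)
  have der: "((\<lambda>t. f (\<gamma> s t) - g (\<gamma> s t)) has_real_derivative s * p (\<gamma> s t)) (at t within {0..d})"
    and der2: "((\<lambda>t. s * p (\<gamma> s t)) has_real_derivative s * (s * k)) (at 0 within {0..d})"
    if "feasible s d" "t \<in> {0..d}" for s d t
  proof -
    have seg: "\<And>t. t \<in> {0..d} \<Longrightarrow> x + (t * s) *\<^sub>R axis i 1 \<in> Omega"
      using that by (auto simp: feasible_def \<gamma>_def)
    show "((\<lambda>t. f (\<gamma> s t) - g (\<gamma> s t)) has_real_derivative s * p (\<gamma> s t)) (at t within {0..d})"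
      using DERIV_diff[OF pderiv_Omega_along_segment[OF diff(1) seg \<open>t \<in> {0..d}\<close>]
          pderiv_Omega_along_segment[OF diff(3) seg \<open>t \<in> {0..d}\<close>]]
      by (simp add: \<gamma>_def p_def right_diff_distrib)
    have 0: "0 \<in> {0..d}" using that by simp
    show "((\<lambda>t. s * p (\<gamma> s t)) has_real_derivative s * (s * k)) (at 0 within {0..d})"
      using DERIV_cmult[OF DERIV_diff[OF pderiv_Omega_along_segment[OF diff(2) seg 0]
          pderiv_Omega_along_segment[OF diff(4) seg 0]], of s]
      by (simp add: \<gamma>_def p_def k_def right_diff_distrib)
  qed
  have max_seg: "f (\<gamma> s t) - g (\<gamma> s t) \<le> f (\<gamma> s 0) - g (\<gamma> s 0)"
    if "feasible s d" "t \<in> {0..d}" for s d t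
    using that max by (auto simp: feasible_def \<gamma>0)
  have first: "s * p x \<le> 0" if "feasible s d" for s d
    using deriv_le_0_at_left_max[of d "\<lambda>t. f (\<gamma> s t) - g (\<gamma> s t)" "s * p x"]
      der[OF that, of 0] max_seg[OF that] that by (simp add: feasible_def \<gamma>0)
  have \<gamma>_nth: "\<gamma> s t $ j = (if j = i then x $ i + t * s else x $ j)" for s t j
    by (simp add: \<gamma>_def axis_def)
  have x_bound: "-1 \<le> x $ j" "x $ j \<le> 1" for j
    using x by (simp_all add: mem_Omega_iff)
  have feasible_up: "feasible 1 (1 - x $ i)" if "x $ i < 1"
    unfolding feasible_def mem_Omega_iff \<gamma>_nth
  proof (intro conjI ballI allI)
    fix t j assume "t \<in> {0..1 - x $ i}"
    then show "-1 \<le> (if j = i then x $ i + t * 1 else x $ j)"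
      "(if j = i then x $ i + t * 1 else x $ j) \<le> 1"
      using x_bound[of j] by (cases "j = i"; simp)+
  qed (use that in simp)
  have feasible_down: "feasible (-1) (x $ i + 1)" if "-1 < x $ i"
    unfolding feasible_def mem_Omega_iff \<gamma>_nth
  proof (intro conjI ballI allI)
    fix t j assume "t \<in> {0..x $ i + 1}"
    then show "-1 \<le> (if j = i then x $ i + t * (-1) else x $ j)"
      "(if j = i then x $ i + t * (-1) else x $ j) \<le> 1"
      using x_bound[of j] by (cases "j = i"; simp)+
  qed (use that in simp)
  have "p x = 0"
  proof (cases "x $ i = -1 \<or> x $ i = 1")
    case True
    then show ?thesis using f(2) g(2) x by (auto simp: neumann_def p_def)
  next
    case False
    then have "-1 < x $ i" "x $ i < 1" using x_bound[of i] by simp_all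
    then show ?thesis using first[OF feasible_up] first[OF feasible_down] by simp
  qed
  obtain s d where sd: "feasible s d" "s * s = (1::real)"
  proof (cases "x $ i < 1")
    case True
    show ?thesis using that[OF feasible_up[OF True]] by simp
  next
    case False
    then have "-1 < x $ i" by simp
    from that[OF feasible_down[OF this]] show ?thesis by simp
  qed
  have "s * (s * k) \<le> 0"
    using second_deriv_le_0_at_left_max[of d "\<lambda>t. f (\<gamma> s t) - g (\<gamma> s t)" "\<lambda>t. s * p (\<gamma> s t)"]
      der[OF sd(1)] der2[OF sd(1), of 0] max_seg[OF sd(1)] sd(1) \<open>p x = 0\<close>
    by (simp add: feasible_def \<gamma>0)
  then show ?thesis using sd(2) by (simp add: k_def flip: mult.assoc)
qed

lemma laplacian_le_at_max:
  fixes f g :: "real ^ 'd::finite \<Rightarrow> real"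
  assumes "smooth_Omega f" "neumann f" "smooth_Omega g" "neumann g"
    and "x \<in> Omega" and "\<And>y. y \<in> Omega \<Longrightarrow> f y - g y \<le> f x - g x"
  shows "laplacian f x \<le> laplacian g x"
  unfolding laplacian_def by (intro sum_mono second_pderiv_le_at_max assms)

text \<open>The nonlinearity treated implicitly is the derivative of a convex function of \<open>y\<close>.\<close>

lemma splitting_nonlinearity_mono:
  fixes a y z :: real
  assumes "z \<le> y"
  shows "(z + a) * (z\<^sup>2 + a\<^sup>2) \<le> (y + a) * (y\<^sup>2 + a\<^sup>2)"
proof -
  have "(y + a) * (y\<^sup>2 + a\<^sup>2) - (z + a) * (z\<^sup>2 + a\<^sup>2)
      = (y - z) * (((y + z)\<^sup>2 + (y + a)\<^sup>2 + (z + a)\<^sup>2) / 2)"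
    by (simp add: field_simps power2_eq_square)
  also have "\<dots> \<ge> 0" using assms by simp
  finally show ?thesis by simp
qed

lemma convex_splitting_mCN_comparison:
  fixes \<phi> \<psi>\<^sub>1 \<psi>\<^sub>2 :: "real ^ 'd::finite \<Rightarrow> real"
  assumes "dt > 0"
    and 1: "smooth_Omega \<psi>\<^sub>1" "neumann \<psi>\<^sub>1" "convex_splitting_mCN \<epsilon> dt \<phi> \<psi>\<^sub>1"
    and 2: "smooth_Omega \<psi>\<^sub>2" "neumann \<psi>\<^sub>2" "convex_splitting_mCN \<epsilon> dt \<phi> \<psi>\<^sub>2"
    and y: "y \<in> Omega"
  shows "\<psi>\<^sub>1 y \<le> \<psi>\<^sub>2 y"
proof -
  have "continuous_on Omega \<psi>\<^sub>1" "continuous_on Omega \<psi>\<^sub>2"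
    using 1(1)[unfolded smooth_Omega_def, rule_format, of 0]
      2(1)[unfolded smooth_Omega_def, rule_format, of 0] by simp_all
  then have "continuous_on Omega (\<lambda>x. \<psi>\<^sub>1 x - \<psi>\<^sub>2 x)"
    by (intro continuous_on_diff)
  moreover have "compact (Omega :: (real ^ 'd) set)" by (simp add: Omega_def compact_cbox)
  ultimately obtain x where x: "x \<in> Omega"
    and max: "\<And>y. y \<in> Omega \<Longrightarrow> \<psi>\<^sub>1 y - \<psi>\<^sub>2 y \<le> \<psi>\<^sub>1 x - \<psi>\<^sub>2 x"
    using continuous_attains_sup[of Omega "\<lambda>x. \<psi>\<^sub>1 x - \<psi>\<^sub>2 x"] y by blast
  have lap: "laplacian \<psi>\<^sub>1 x \<le> laplacian \<psi>\<^sub>2 x"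
    by (rule laplacian_le_at_max[OF 1(1,2) 2(1,2) x max])
  have "\<psi>\<^sub>1 x \<le> \<psi>\<^sub>2 x"
  proof (rule ccontr)
    assume "\<not> \<psi>\<^sub>1 x \<le> \<psi>\<^sub>2 x"
    then have less: "\<psi>\<^sub>2 x < \<psi>\<^sub>1 x" by simp
    define N where "N = (\<lambda>u. 1 / (4 * \<epsilon>\<^sup>2) * (u + \<phi> x) * (u\<^sup>2 + (\<phi> x)\<^sup>2))"
    have "N (\<psi>\<^sub>2 x) \<le> N (\<psi>\<^sub>1 x)"
      unfolding N_def mult.assoc
      using splitting_nonlinearity_mono[of "\<psi>\<^sub>2 x" "\<psi>\<^sub>1 x" "\<phi> x"] less
      by (intro mult_left_mono) auto
    moreover have "(\<psi>\<^sub>2 x - \<phi> x) / dt < (\<psi>\<^sub>1 x - \<phi> x) / dt"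
      using less \<open>dt > 0\<close> by (simp add: divide_strict_right_mono)
    moreover have
      "(\<psi>\<^sub>1 x - \<phi> x) / dt - 1 / 2 * (laplacian \<psi>\<^sub>1 x + laplacian \<phi> x) + N (\<psi>\<^sub>1 x) - 1 / \<epsilon>\<^sup>2 * \<phi> x = 0"
      "(\<psi>\<^sub>2 x - \<phi> x) / dt - 1 / 2 * (laplacian \<psi>\<^sub>2 x + laplacian \<phi> x) + N (\<psi>\<^sub>2 x) - 1 / \<epsilon>\<^sup>2 * \<phi> x = 0"
      using 1(3) 2(3) x unfolding convex_splitting_mCN_def N_def by blast+
    ultimately show False using lap by argo
  qed
  then show ?thesis using max[OF y] by simp
qed

theorem mainTheorem3:
  fixes \<epsilon> :: real
  assumes "\<epsilon> > 0"
  shows "unconditionally_stable (convex_splitting_mCN \<epsilon> :: 'd::finite scheme)"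
  unfolding unconditionally_stable_def stable_def
  by (blast intro: antisym convex_splitting_mCN_comparison)

end
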